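(* Let $\Gamma$ be a $4$-regular infinite planar tessellation with non-negative combinatorial curvature and let $\sigma$ be a face of degree $k$ with $8\le k\le 12$. Then $$\sum_{z\in\partial\sigma}\tilde\Phi(z)>\frac12\quad\text{if }8\le k\le 11,\qquad \sum_{z\in\partial\sigma}\tilde\Phi(z)\ge\frac12\quad\text{if }k=12.$$
   Context: A planar tessellation is a locally finite, connected, simple graph embedded in $\mathbb S^2$ or $\mathbb R^2$, with faces the components of the complement, such that: (i) every closed face is a closed disk bounded by finitely many edges; (ii) every edge lies in exactly two different closed faces; (iii) two distinct closed faces intersect in the empty set, a single vertex, or the closure of a single edge; all vertex and face degrees (face degree = number of boundary edges) are at least $3$. Infinite means embedded in $\mathbb R^2$. The combinatorial curvature at a vertex $x$ is $\Phi(x)=1-\frac{|x|}{2}+\sum_{\sigma}\frac{1}{|\sigma|}$, summed over faces whose closure contains $x$; non-negative curvature means $\Phi\ge0$ at every vertex. $4$-regular means all vertices have degree $4$. $\partial\sigma$ is the set of vertices in the closure of the face $\sigma$; $U_1(\sigma)=\partial\sigma\cup\{x:x\sim z\text{ for some }z\in\partial\sigma\}$ ($\sim$ = adjacency) and $\partial U_1(\sigma)=U_1(\sigma)\setminus\partial\sigma$. Let $W=\bigcup\partial\sigma'$ and $W_1=\bigcup\partial U_1(\sigma')$, both unions over all faces $\sigma'$ with $8\le|\sigma'|\le12$. The modified curvature at a vertex $x\in W$ is $\tilde\Phi(x)=\Phi(x)+\frac12\sum_{y\in W_1,\,y\sim x}\Phi(y)$. *)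

theory Defs
  imports "HOL-Analysis.Analysis"
begin

text \<open>
  A graph drawn in the plane is given by its vertex set \<open>V\<close> (points) and its edge set \<open>E\<close>.
  An edge is represented by its \<^emph>\<open>closed\<close> arc, i.e. including its two end vertices, so
  the closure of an open edge is simply an element of \<open>E\<close>. The end vertices of \<open>e\<close> are \<open>e \<inter> V\<close>.
\<close>

definition plane_graph :: "(real^2) set \<Rightarrow> (real^2) set set \<Rightarrow> bool" where
  "plane_graph V E \<longleftrightarrow>
     (\<forall>e\<in>E. \<exists>g. arc g \<and> path_image g = e \<and> e \<inter> V = {pathstart g, pathfinish g}) \<and>
     (\<forall>e\<in>E. \<forall>e'\<in>E. e \<noteq> e' \<longrightarrow> e \<inter> e' \<subseteq> V)"

text \<open>Loops are already excluded because the end points of an \<^const>\<open>arc\<close> are distinct.\<close>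

definition simple_plane_graph :: "(real^2) set \<Rightarrow> (real^2) set set \<Rightarrow> bool" where
  "simple_plane_graph V E \<longleftrightarrow>
     plane_graph V E \<and> (\<forall>e\<in>E. \<forall>e'\<in>E. e \<inter> V = e' \<inter> V \<longrightarrow> e = e')"

definition adjacent :: "(real^2) set \<Rightarrow> (real^2) set set \<Rightarrow> real^2 \<Rightarrow> real^2 \<Rightarrow> bool" where
  "adjacent V E x y \<longleftrightarrow> (\<exists>e\<in>E. e \<inter> V = {x, y})"

definition connected_graph :: "(real^2) set \<Rightarrow> (real^2) set set \<Rightarrow> bool" where
  "connected_graph V E \<longleftrightarrow> (\<forall>x\<in>V. \<forall>y\<in>V. (adjacent V E)\<^sup>*\<^sup>* x y)"

definition locally_finite_graph :: "(real^2) set \<Rightarrow> (real^2) set set \<Rightarrow> bool" where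
  "locally_finite_graph V E \<longleftrightarrow> (\<forall>x\<in>V. finite {e \<in> E. x \<in> e})"

definition vertex_degree :: "(real^2) set set \<Rightarrow> real^2 \<Rightarrow> nat" where
  "vertex_degree E x = card {e \<in> E. x \<in> e}"

definition faces :: "(real^2) set \<Rightarrow> (real^2) set set \<Rightarrow> (real^2) set set" where
  "faces V E = components (- (V \<union> \<Union>E))"

definition closed_faces :: "(real^2) set \<Rightarrow> (real^2) set set \<Rightarrow> (real^2) set set" where
  "closed_faces V E = closure ` faces V E"

definition face_degree :: "(real^2) set set \<Rightarrow> (real^2) set \<Rightarrow> nat" where
  "face_degree E \<sigma> = card {e \<in> E. e \<subseteq> frontier (closure \<sigma>)}"

definition infinite_planar_tessellation :: "(real^2) set \<Rightarrow> (real^2) set set \<Rightarrow> bool" where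
  "infinite_planar_tessellation V E \<longleftrightarrow>
     simple_plane_graph V E \<and> connected_graph V E \<and> locally_finite_graph V E \<and>
     (\<forall>D\<in>closed_faces V E. D homeomorphic cball (0::real^2) 1 \<and>
        (\<exists>B\<subseteq>E. finite B \<and> frontier D = \<Union>B)) \<and>
     (\<forall>e\<in>E. card {D \<in> closed_faces V E. e \<subseteq> D} = 2) \<and>
     (\<forall>D\<in>closed_faces V E. \<forall>D'\<in>closed_faces V E. D \<noteq> D' \<longrightarrow>
        D \<inter> D' = {} \<or> (\<exists>v\<in>V. D \<inter> D' = {v}) \<or> (\<exists>e\<in>E. D \<inter> D' = e)) \<and>
     (\<forall>x\<in>V. vertex_degree E x \<ge> 3) \<and>
     (\<forall>\<sigma>\<in>faces V E. face_degree E \<sigma> \<ge> 3)"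

definition curvature :: "(real^2) set \<Rightarrow> (real^2) set set \<Rightarrow> real^2 \<Rightarrow> real" where
  "curvature V E x = 1 - real (vertex_degree E x) / 2
     + (\<Sum>\<sigma> | \<sigma> \<in> faces V E \<and> x \<in> closure \<sigma>. 1 / real (face_degree E \<sigma>))"

definition face_vertices :: "(real^2) set \<Rightarrow> (real^2) set \<Rightarrow> (real^2) set" where
  "face_vertices V \<sigma> = V \<inter> closure \<sigma>"

definition face_nbhd :: "(real^2) set \<Rightarrow> (real^2) set set \<Rightarrow> (real^2) set \<Rightarrow> (real^2) set" where
  "face_nbhd V E \<sigma> = face_vertices V \<sigma> \<union> {x \<in> V. \<exists>z\<in>face_vertices V \<sigma>. adjacent V E x z}"

definition face_nbhd_boundary ::
    "(real^2) set \<Rightarrow> (real^2) set set \<Rightarrow> (real^2) set \<Rightarrow> (real^2) set" where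
  "face_nbhd_boundary V E \<sigma> = face_nbhd V E \<sigma> - face_vertices V \<sigma>"

text \<open>The union \<open>W\<^sub>1\<close> of the sets \<open>\<partial>U\<^sub>1(\<sigma>')\<close> over all faces with \<open>8 \<le> |\<sigma>'| \<le> 12\<close>.\<close>

definition large_face_neighbours :: "(real^2) set \<Rightarrow> (real^2) set set \<Rightarrow> (real^2) set" where
  "large_face_neighbours V E =
     (\<Union>\<sigma> \<in> {\<sigma> \<in> faces V E. 8 \<le> face_degree E \<sigma> \<and> face_degree E \<sigma> \<le> 12}.
        face_nbhd_boundary V E \<sigma>)"

text \<open>Only meaningful at vertices of faces \<open>\<sigma>'\<close> with \<open>8 \<le> |\<sigma>'| \<le> 12\<close> (the set \<open>W\<close>).\<close>

definition modified_curvature :: "(real^2) set \<Rightarrow> (real^2) set set \<Rightarrow> real^2 \<Rightarrow> real" where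
  "modified_curvature V E x = curvature V E x
     + 1/2 * (\<Sum>y | y \<in> large_face_neighbours V E \<and> adjacent V E y x. curvature V E y)"

end

theory Submission
  imports Defs
begin

text \<open>
  All vertices of a face \<open>\<sigma>\<close> with \<open>k \<ge> 8\<close> sides have type \<open>(3,3,3,k)\<close> or \<open>(3,3,4,k)\<close>, so their
  curvature is \<open>1/k\<close> or \<open>1/k - 1/12\<close>. A vertex \<open>z\<close> has two neighbours \<open>p, q\<close> outside \<open>\<sigma>\<close>. Let
  \<open>\<gamma> z = 1\<close> if the face opposite to \<open>\<sigma>\<close> at \<open>z\<close> is a square, and \<open>0\<close> otherwise, and let \<open>u, u'\<close> be the
  neighbours of \<open>z\<close> along \<open>\<sigma>\<close>. If one of the faces at \<open>z\<close> is a square, then non-negativity of the curvature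
  at the far corner of the opposite square, or at the outer neighbour that is a corner of the
  square adjacent to \<open>\<sigma>\<close>, forces
  \<open>\<Phi> p + \<Phi> q \<ge> (1 + 2 \<gamma> z - \<gamma> u - \<gamma> u') / 12\<close>.
  The \<open>\<gamma>\<close>-terms cancel in the sum over the boundary of \<open>\<sigma>\<close>, and the total is at least \<open>1 - k/24\<close>.

  All this uses only that every vertex lies on four faces which are arranged cyclically. That
  property follows by counting once two topological facts are known: every face is the interior of its
  closure, and exactly two sides of a face meet at each of its vertices.
\<close>

section \<open>Four-regular polygonal complexes\<close>

text \<open>\<open>common_side\<close> is axiom (iii) expressed through sides: two faces that share
  an edge have no common corner off that edge. Faces without a shared side are left
  unrestricted.\<close>

locale four_regular_complex =
  fixes V :: "'v set" and E :: "'e set" and F :: "'f set"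
    and ends :: "'e \<Rightarrow> 'v set" and sides :: "'f \<Rightarrow> 'e set"
  assumes ends_subset: "e \<in> E \<Longrightarrow> ends e \<subseteq> V"
    and card_ends: "e \<in> E \<Longrightarrow> card (ends e) = 2"
    and ends_inject: "e \<in> E \<Longrightarrow> e' \<in> E \<Longrightarrow> ends e = ends e' \<Longrightarrow> e = e'"
    and card_edges_at: "v \<in> V \<Longrightarrow> card {e \<in> E. v \<in> ends e} = 4"
    and sides_subset: "f \<in> F \<Longrightarrow> sides f \<subseteq> E"
    and card_sides: "f \<in> F \<Longrightarrow> 3 \<le> card (sides f)"
    and card_faces_at_edge: "e \<in> E \<Longrightarrow> card {f \<in> F. e \<in> sides f} = 2"
    and card_sides_at: "f \<in> F \<Longrightarrow> e \<in> sides f \<Longrightarrow> v \<in> ends e \<Longrightarrow>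
        card {e \<in> sides f. v \<in> ends e} = 2"
    and common_side: "f \<in> F \<Longrightarrow> g \<in> F \<Longrightarrow> f \<noteq> g \<Longrightarrow> e \<in> sides f \<Longrightarrow> e \<in> sides g \<Longrightarrow>
        a \<in> sides f \<Longrightarrow> v \<in> ends a \<Longrightarrow> b \<in> sides g \<Longrightarrow> v \<in> ends b \<Longrightarrow> v \<in> ends e"
begin

section \<open>Incidences of corners, sides and faces\<close>

definition corners :: "'f \<Rightarrow> 'v set" where
  "corners f = (\<Union>e\<in>sides f. ends e)"

definition sides_at :: "'f \<Rightarrow> 'v \<Rightarrow> 'e set" where
  "sides_at f v = {e \<in> sides f. v \<in> ends e}"

text \<open>The constant -1 is 1 - 4/2, the contribution of the four edges.\<close>

definition curv :: "'v \<Rightarrow> real" where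
  "curv v = -1 + (\<Sum>f | f \<in> F \<and> v \<in> corners f. 1 / real (card (sides f)))"

lemma finite_ends: "e \<in> E \<Longrightarrow> finite (ends e)"
  using card_ends card.infinite by fastforce

lemma finite_sides: "f \<in> F \<Longrightarrow> finite (sides f)"
  using card_sides card.infinite by fastforce

lemma finite_corners: "f \<in> F \<Longrightarrow> finite (corners f)"
  unfolding corners_def using finite_sides finite_ends sides_subset by blast

lemma sides_in_E: "f \<in> F \<Longrightarrow> e \<in> sides f \<Longrightarrow> e \<in> E"
  using sides_subset by blast

lemma ends_in_corners: "e \<in> sides f \<Longrightarrow> v \<in> ends e \<Longrightarrow> v \<in> corners f"
  unfolding corners_def by blast

lemma sides_at_eq:
  assumes "f \<in> F" "a \<in> sides f" "b \<in> sides f" "v \<in> ends a" "v \<in> ends b" "a \<noteq> b"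
  shows "sides_at f v = {a, b}"
proof -
  have "card (sides_at f v) = 2"
    using card_sides_at[of f a v] assms unfolding sides_at_def by blast
  moreover have "{a, b} \<subseteq> sides_at f v" using assms unfolding sides_at_def by blast
  moreover have "finite (sides_at f v)" using finite_sides assms(1) unfolding sides_at_def by auto
  ultimately show ?thesis using card_subset_eq[of "sides_at f v" "{a,b}"] assms(6) by auto
qed

lemma other_side:
  assumes "f \<in> F" "a \<in> sides f" "v \<in> ends a"
  obtains b where "b \<in> sides f" "v \<in> ends b" "b \<noteq> a"
proof -
  have "card {e \<in> sides f. v \<in> ends e} = 2" using card_sides_at assms by blast
  then obtain x y where "{e \<in> sides f. v \<in> ends e} = {x, y}" "x \<noteq> y" by (meson card_2_iff)
  then have "x \<in> {e \<in> sides f. v \<in> ends e}" "y \<in> {e \<in> sides f. v \<in> ends e}" "x \<noteq> y" by auto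
  then show ?thesis using that by blast
qed

lemma sides_at_cases:
  assumes "f \<in> F" "a \<in> sides f" "b \<in> sides f" "c \<in> sides f" "v \<in> ends a" "v \<in> ends b" "v \<in> ends c" "a \<noteq> b"
  shows "c = a \<or> c = b"
  using sides_at_eq[of f a b v] assms unfolding sides_at_def by blast

lemma other_face:
  assumes "f \<in> F" "a \<in> sides f"
  obtains g where "g \<in> F" "a \<in> sides g" "g \<noteq> f"
proof -
  have "card {f \<in> F. a \<in> sides f} = 2" using card_faces_at_edge sides_in_E assms by blast
  then obtain x y where "{f \<in> F. a \<in> sides f} = {x, y}" "x \<noteq> y" by (meson card_2_iff)
  then have "x \<in> {f \<in> F. a \<in> sides f}" "y \<in> {f \<in> F. a \<in> sides f}" "x \<noteq> y" by auto
  then show ?thesis using that by blast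
qed

lemma faces_at_edge_cases:
  assumes "f \<in> F" "g \<in> F" "h \<in> F" "a \<in> sides f" "a \<in> sides g" "a \<in> sides h" "f \<noteq> g"
  shows "h = f \<or> h = g"
proof -
  have "card {f \<in> F. a \<in> sides f} = 2" using card_faces_at_edge sides_in_E assms by blast
  then obtain x y where "{f \<in> F. a \<in> sides f} = {x, y}" by (meson card_2_iff)
  then have "f \<in> {x,y}" "g \<in> {x,y}" "h \<in> {x,y}" using assms by blast+
  then show ?thesis using assms(7) by auto
qed

text \<open>By \<open>common_side\<close> both ends of \<open>b\<close> are ends of
  \<open>a\<close>, and the graph is simple.\<close>

lemma common_side_unique:
  assumes "f \<in> F" "g \<in> F" "f \<noteq> g" "a \<in> sides f" "a \<in> sides g" "b \<in> sides f" "b \<in> sides g"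
  shows "a = b"
proof -
  have "ends b \<subseteq> ends a" using common_side[of f g a b _ b] assms by blast
  moreover have "a \<in> E" "b \<in> E" using assms sides_in_E by auto
  ultimately have "ends b = ends a"
    using card_subset_eq[of "ends a" "ends b"] card_ends finite_ends by simp
  then show ?thesis using ends_inject \<open>a \<in> E\<close> \<open>b \<in> E\<close> by blast
qed

lemma two_ends_eq:
  assumes "e \<in> E" "x \<in> ends e" "y \<in> ends e" "x \<noteq> y"
  shows "ends e = {x, y}"
  using card_subset_eq[of "ends e" "{x,y}"] assms card_ends[of e] finite_ends[of e] by auto

lemma other_end:
  assumes "e \<in> E" "x \<in> ends e"
  obtains y where "ends e = {x, y}" "x \<noteq> y"
  using card_ends[OF assms(1)] assms(2) by (metis card_2_iff insert_commute insert_iff singletonD)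

lemma common_ends_unique:
  assumes "a \<in> E" "b \<in> E" "x \<in> ends a" "y \<in> ends a" "x \<in> ends b" "y \<in> ends b" "x \<noteq> y"
  shows "a = b"
  using two_ends_eq assms ends_inject by metis

text \<open>The cyclic order around \<open>v\<close> is \<open>A, a, P, c, R, d, Q, b\<close>: faces and edges alternate, and \<open>R\<close> is
  opposite to \<open>A\<close>.\<close>

definition link :: "'v \<Rightarrow> 'f \<Rightarrow> 'e \<Rightarrow> 'e \<Rightarrow> 'f \<Rightarrow> 'e \<Rightarrow> 'f \<Rightarrow> 'e \<Rightarrow> 'f \<Rightarrow> bool" where
  "link v A a b P c Q d R \<longleftrightarrow>
     {f \<in> F. v \<in> corners f} = {A, P, Q, R} \<and> distinct [A, P, Q, R] \<and>
     {e \<in> E. v \<in> ends e} = {a, b, c, d} \<and> distinct [a, b, c, d] \<and>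
     sides_at A v = {a, b} \<and> sides_at P v = {a, c} \<and> sides_at Q v = {b, d} \<and> sides_at R v = {c, d}"

text \<open>Let \<open>c\<close> and \<open>d\<close> be the second sides of \<open>P\<close> and
  \<open>Q\<close> at \<open>v\<close>. If \<open>c = d\<close>, the faces \<open>A, P, Q\<close>
  close up around \<open>v\<close> on three edges; a face at the fourth edge would need a second
  side at \<open>v\<close>, but \<open>a, b, c\<close> already have two faces each, so a fifth edge
  would arise. Hence \<open>a, b, c, d\<close> are all edges at \<open>v\<close>, and the face
  beyond \<open>c\<close> can only continue with \<open>d\<close>.\<close>

lemma link_exists:
  assumes A: "A \<in> F" "a \<in> sides A" "b \<in> sides A" "a \<noteq> b" "v \<in> ends a" "v \<in> ends b"
    and P: "P \<in> F" "a \<in> sides P" "P \<noteq> A"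
    and Q: "Q \<in> F" "b \<in> sides Q" "Q \<noteq> A"
  obtains c d R where "link v A a b P c Q d R"
proof -
  have v: "v \<in> V" using ends_subset sides_in_E A by blast
  obtain c where c: "c \<in> sides P" "v \<in> ends c" "c \<noteq> a" using other_side P A by metis
  obtain d where d: "d \<in> sides Q" "v \<in> ends d" "d \<noteq> b" using other_side Q A by metis
  have PQ: "P \<noteq> Q" using common_side_unique[of A P a b] A P Q by blast
  have bP: "b \<notin> sides P" using common_side_unique[of A P a b] A P by blast
  have aQ: "a \<notin> sides Q" using common_side_unique[of A Q a b] A Q by blast
  have cb: "c \<noteq> b" "d \<noteq> a" using bP aQ c d by auto
  have EE: "a \<in> E" "b \<in> E" "c \<in> E" "d \<in> E" using sides_in_E A(1-3) P(1) Q(1) c(1) d(1) by simp_all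
  have cA: "c \<notin> sides A" using common_side_unique[of A P a c] A P c by blast
  have c4: "card {e \<in> E. v \<in> ends e} = 4" using card_edges_at v by blast
  have fin: "finite {e \<in> E. v \<in> ends e}" using c4 by (intro card_ge_0_finite) simp
  have cd: "c \<noteq> d"
  proof
    assume cd: "c = d"
    have "\<not> {e \<in> E. v \<in> ends e} \<subseteq> {a, b, c}"
    proof
      assume "{e \<in> E. v \<in> ends e} \<subseteq> {a, b, c}"
      then have "card {e \<in> E. v \<in> ends e} \<le> card {a,b,c}" by (intro card_mono) auto
      also have "\<dots> \<le> 3" by (simp add: card_insert_if)
      finally show False using c4 by simp
    qed
    then obtain w where w: "w \<in> E" "v \<in> ends w" "w \<noteq> a" "w \<noteq> b" "w \<noteq> c" by blast
    have "{f \<in> F. w \<in> sides f} \<noteq> {}" using card_faces_at_edge[OF w(1)] by force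
    then obtain R where R: "R \<in> F" "w \<in> sides R" by blast
    have wA: "w \<notin> sides A" using sides_at_cases[of A a b w v] A w by blast
    have wP: "w \<notin> sides P" using sides_at_cases[of P a c w v] A P c w by blast
    have wQ: "w \<notin> sides Q" using sides_at_cases[of Q b d w v] A Q d w cd by blast
    obtain u where u: "u \<in> sides R" "v \<in> ends u" "u \<noteq> w" using other_side R w by metis
    have RR: "R \<noteq> A" "R \<noteq> P" "R \<noteq> Q" using wA wP wQ R by auto
    have "u \<noteq> a" using faces_at_edge_cases[of A P R a] A P R u RR by blast
    moreover have "u \<noteq> b" using faces_at_edge_cases[of A Q R b] A Q R u RR by blast
    moreover have "u \<noteq> c" using faces_at_edge_cases[of P Q R c] P Q R u RR c d cd PQ by blast
    ultimately have "card {a, b, c, w, u} = 5" using w u A c cb by auto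
    moreover have "card {a, b, c, w, u} \<le> card {e \<in> E. v \<in> ends e}"
      using fin by (intro card_mono) (use A c w u EE R sides_in_E in auto)
    ultimately show False using c4 by simp
  qed
  have edges: "{e \<in> E. v \<in> ends e} = {a, b, c, d}"
  proof -
    have "card {a, b, c, d} = 4" using A c d cb cd by auto
    moreover have "{a, b, c, d} \<subseteq> {e \<in> E. v \<in> ends e}" using EE A c d by auto
    ultimately show ?thesis using card_subset_eq[OF fin] c4 by metis
  qed
  obtain R where R: "R \<in> F" "c \<in> sides R" "R \<noteq> P" using other_face[OF P(1) c(1)] by blast
  have RA: "R \<noteq> A" using R cA by blast
  have RQ: "R \<noteq> Q"
  proof
    assume "R = Q" then show False using sides_at_cases[of Q b d c v] A Q d c R cb cd by blast
  qed
  obtain d' where d': "d' \<in> sides R" "v \<in> ends d'" "d' \<noteq> c" using other_side R c by metis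
  have "d' \<noteq> a" using faces_at_edge_cases[of A P R a] A P R RA d' by blast
  moreover have "d' \<noteq> b" using faces_at_edge_cases[of A Q R b] A Q R RA RQ d' by blast
  moreover have "d' \<in> {a, b, c, d}" using edges d' R sides_in_E by blast
  ultimately have dR: "d \<in> sides R" using d' by auto
  have faces: "{f \<in> F. v \<in> corners f} = {A, P, Q, R}"
  proof
    show "{A, P, Q, R} \<subseteq> {f \<in> F. v \<in> corners f}"
      using A(1) P(1) Q(1) R(1) ends_in_corners[OF A(2,5)] ends_in_corners[OF P(2) A(5)]
        ends_in_corners[OF Q(2) A(6)] ends_in_corners[OF R(2) c(2)] by simp
    show "{f \<in> F. v \<in> corners f} \<subseteq> {A, P, Q, R}"
    proof
      fix f assume "f \<in> {f \<in> F. v \<in> corners f}"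
      then obtain x where f: "f \<in> F" "x \<in> sides f" "v \<in> ends x" unfolding corners_def by blast
      then have "x \<in> {a, b, c, d}" using edges sides_in_E by blast
      then show "f \<in> {A, P, Q, R}"
        using faces_at_edge_cases[of A P f a] faces_at_edge_cases[of A Q f b]
          faces_at_edge_cases[of P R f c] faces_at_edge_cases[of Q R f d]
          A(1-3) P Q R RQ c(1) d(1) dR f(1,2) by auto
    qed
  qed
  have "link v A a b P c Q d R"
    unfolding link_def faces edges
    using sides_at_eq[of A a b v] sides_at_eq[of P a c v] sides_at_eq[of Q b d v] sides_at_eq[of R c d v]
      A P Q R c d dR RA RQ PQ cb cd by auto
  then show ?thesis using that by blast
qed

lemma linkD:
  assumes "link v A a b P c Q d R"
  shows "A \<in> F" "P \<in> F" "Q \<in> F" "R \<in> F" "a \<in> E" "b \<in> E" "c \<in> E" "d \<in> E"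
    "v \<in> ends a" "v \<in> ends b" "v \<in> ends c" "v \<in> ends d"
    "a \<in> sides A" "b \<in> sides A" "a \<in> sides P" "c \<in> sides P" "b \<in> sides Q" "d \<in> sides Q"
    "c \<in> sides R" "d \<in> sides R" "distinct [A, P, Q, R]" "distinct [a, b, c, d]"
proof -
  have F: "{A, P, Q, R} = {f \<in> F. v \<in> corners f}" and E: "{a, b, c, d} = {e \<in> E. v \<in> ends e}"
    and S: "{a, b} = sides_at A v" "{a, c} = sides_at P v" "{b, d} = sides_at Q v" "{c, d} = sides_at R v"
    and "distinct [A, P, Q, R]" "distinct [a, b, c, d]"
    using assms unfolding link_def by (elim conjE, simp)+
  then show "distinct [A, P, Q, R]" "distinct [a, b, c, d]" by blast+
  have "A \<in> {A, P, Q, R}" "P \<in> {A, P, Q, R}" "Q \<in> {A, P, Q, R}" "R \<in> {A, P, Q, R}" by simp_all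
  then show "A \<in> F" "P \<in> F" "Q \<in> F" "R \<in> F" unfolding F by simp_all
  have "a \<in> {a, b, c, d}" "b \<in> {a, b, c, d}" "c \<in> {a, b, c, d}" "d \<in> {a, b, c, d}" by simp_all
  then show "a \<in> E" "b \<in> E" "c \<in> E" "d \<in> E"
    "v \<in> ends a" "v \<in> ends b" "v \<in> ends c" "v \<in> ends d" unfolding E by simp_all
  have "a \<in> {a, b}" "b \<in> {a, b}" "a \<in> {a, c}" "c \<in> {a, c}" "b \<in> {b, d}" "d \<in> {b, d}"
    "c \<in> {c, d}" "d \<in> {c, d}" by simp_all
  then show "a \<in> sides A" "b \<in> sides A" "a \<in> sides P" "c \<in> sides P" "b \<in> sides Q" "d \<in> sides Q"
    "c \<in> sides R" "d \<in> sides R" unfolding S sides_at_def by simp_all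
qed

lemma curv_link:
  assumes "link v A a b P c Q d R"
  shows "curv v = -1 + 1 / card (sides A) + 1 / card (sides P) + 1 / card (sides Q) + 1 / card (sides R)"
  using assms unfolding link_def curv_def by simp

text \<open>Reflection of the cyclic order; it transfers each one-sided estimate to the other
  side.\<close>

lemma link_swap: "link v A a b P c Q d R \<Longrightarrow> link v A b a Q d P c R"
  unfolding link_def by (simp add: insert_commute) blast

text \<open>The second sides at \<open>p\<close> and at \<open>q\<close> must coincide, since
  otherwise the face would have four sides.\<close>

lemma triangle:
  assumes "f \<in> F" "card (sides f) = 3" "a \<in> sides f" "b \<in> sides f" "a \<noteq> b"
    and "ends a = {z, p}" "ends b = {z, q}"
  obtains t where "t \<in> sides f" "t \<noteq> a" "t \<noteq> b" "ends t = {p, q}" "p \<noteq> q"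
proof -
  have E: "a \<in> E" "b \<in> E" using assms sides_in_E by auto
  have zp: "z \<noteq> p" "z \<noteq> q" using card_ends[OF E(1)] card_ends[OF E(2)] assms by auto
  have pq: "p \<noteq> q" using assms ends_inject E by blast
  obtain a' where a': "a' \<in> sides f" "p \<in> ends a'" "a' \<noteq> a"
    using other_side[of f a p] assms by auto
  obtain b' where b': "b' \<in> sides f" "q \<in> ends b'" "b' \<noteq> b"
    using other_side[of f b q] assms by auto
  have ne: "a' \<noteq> b" "b' \<noteq> a" using a' b' assms zp pq by auto
  have "a' = b'"
  proof (rule ccontr)
    assume "a' \<noteq> b'"
    then have "card {a, b, a', b'} = 4" using assms a' b' ne by auto
    moreover have "card {a, b, a', b'} \<le> card (sides f)"
      using finite_sides assms a' b' by (intro card_mono) auto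
    ultimately show False using assms by simp
  qed
  then have "ends a' = {p, q}" using two_ends_eq[of a' p q] a' b' pq assms sides_in_E by blast
  then show ?thesis using that a' ne pq by blast
qed

text \<open>Continue from \<open>p\<close> along \<open>a'\<close> and from \<open>q\<close> along
  \<open>b'\<close>. If \<open>a' = b'\<close>, a triangle closes up and the remaining side forces a
  fifth one at either of its ends. Otherwise the side following \<open>a'\<close> at its far end
  \<open>w\<close> is \<open>b'\<close>, again because a fifth side is excluded.\<close>

lemma quadrilateral:
  assumes "f \<in> F" "card (sides f) = 4" "a \<in> sides f" "b \<in> sides f" "a \<noteq> b"
    and "ends a = {z, p}" "ends b = {z, q}"
  obtains s t w where "s \<in> sides f" "t \<in> sides f" "s \<noteq> t" "s \<noteq> a" "t \<noteq> b"
    "ends s = {p, w}" "ends t = {q, w}"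
proof -
  have E: "a \<in> E" "b \<in> E" using assms sides_in_E by auto
  have zp: "z \<noteq> p" "z \<noteq> q" using card_ends[OF E(1)] card_ends[OF E(2)] assms by auto
  have pq: "p \<noteq> q" using assms ends_inject E by blast
  obtain a' where a': "a' \<in> sides f" "p \<in> ends a'" "a' \<noteq> a"
    using other_side[of f a p] assms by auto
  obtain b' where b': "b' \<in> sides f" "q \<in> ends b'" "b' \<noteq> b"
    using other_side[of f b q] assms by auto
  have ne: "a' \<noteq> b" "b' \<noteq> a" using a' b' assms zp pq by auto
  have at_z: "x = a \<or> x = b" if "x \<in> sides f" "z \<in> ends x" for x
    using sides_at_cases[of f a b x z] assms that by simp
  have at_p: "x = a \<or> x = a'" if "x \<in> sides f" "p \<in> ends x" for x
    using sides_at_cases[of f a a' x p] assms that a' by auto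
  have at_q: "x = b \<or> x = b'" if "x \<in> sides f" "q \<in> ends x" for x
    using sides_at_cases[of f b b' x q] assms that b' by auto
  have "a' \<noteq> b'"
  proof
    assume eq: "a' = b'"
    then have ea: "ends a' = {p, q}" using two_ends_eq[of a' p q] a' b' pq assms sides_in_E by blast
    have "\<not> sides f \<subseteq> {a, b, a'}"
    proof
      assume "sides f \<subseteq> {a, b, a'}"
      then have "card (sides f) \<le> card {a, b, a'}" by (intro card_mono) auto
      also have "\<dots> \<le> 3" by (simp add: card_insert_if)
      finally show False using assms by simp
    qed
    then obtain x where x: "x \<in> sides f" "x \<noteq> a" "x \<noteq> b" "x \<noteq> a'" by blast
    have "ends x \<noteq> {}" using card_ends[of x] x assms sides_in_E by fastforce
    then obtain u where u: "u \<in> ends x" by blast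
    obtain y where y: "y \<in> sides f" "u \<in> ends y" "y \<noteq> x" using other_side x u assms(1) by metis
    have "u \<noteq> z" "u \<noteq> p" "u \<noteq> q" using at_z at_p at_q x u eq by blast+
    then have "y \<noteq> a" "y \<noteq> b" "y \<noteq> a'" using y assms ea by auto
    then have "card {a, b, a', x, y} = 5" using x y assms a' ne by auto
    moreover have "card {a, b, a', x, y} \<le> card (sides f)"
      using finite_sides assms a' x y by (intro card_mono) auto
    ultimately show False using assms by simp
  qed
  obtain w where w: "ends a' = {p, w}" "p \<noteq> w" using other_end[of a' p] a' assms sides_in_E by blast
  have wz: "w \<noteq> z" using at_z[of a'] a' ne w by blast
  have wq: "w \<noteq> q" using at_q[of a'] a' ne w \<open>a' \<noteq> b'\<close> by blast
  obtain y where y: "y \<in> sides f" "w \<in> ends y" "y \<noteq> a'" using other_side[of f a' w] w a' assms by auto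
  have "y \<noteq> a" "y \<noteq> b" using y assms wz wq w by auto
  have "y = b'"
  proof (rule ccontr)
    assume "y \<noteq> b'"
    then have "card {a, b, a', b', y} = 5"
      using assms a' b' ne y \<open>y \<noteq> a\<close> \<open>y \<noteq> b\<close> \<open>a' \<noteq> b'\<close> by auto
    moreover have "card {a, b, a', b', y} \<le> card (sides f)"
      using finite_sides assms a' b' y by (intro card_mono) auto
    ultimately show False using assms by simp
  qed
  then have "ends b' = {q, w}" using two_ends_eq[of b' q w] b' y wq assms sides_in_E by blast
  then show ?thesis using that a' b' w \<open>a' \<noteq> b'\<close> by blast
qed

text \<open>Double counting of incidences: two sides at each corner, two corners on each
  side.\<close>

lemma card_corners: "f \<in> F \<Longrightarrow> card (corners f) = card (sides f)"
proof -
  assume f: "f \<in> F"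
  have "2 * card (corners f) = (\<Sum>v\<in>corners f. card {e \<in> sides f. v \<in> ends e})"
  proof -
    have "(\<Sum>v\<in>corners f. card {e \<in> sides f. v \<in> ends e}) = (\<Sum>v\<in>corners f. 2)"
    proof (rule sum.cong)
      fix v assume "v \<in> corners f"
      then obtain e where "e \<in> sides f" "v \<in> ends e" unfolding corners_def by blast
      then show "card {e \<in> sides f. v \<in> ends e} = 2" using card_sides_at f by blast
    qed simp
    then show ?thesis by simp
  qed
  also have "\<dots> = 2 * card (sides f)"
  proof (rule sum_multicount)
    show "\<forall>e\<in>sides f. card {v \<in> corners f. v \<in> ends e} = 2"
    proof
      fix e assume e: "e \<in> sides f"
      then have "{v \<in> corners f. v \<in> ends e} = ends e" unfolding corners_def by blast
      then show "card {v \<in> corners f. v \<in> ends e} = 2" using card_ends sides_in_E f e by simp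
    qed
  qed (use finite_corners finite_sides f in auto)
  finally show ?thesis by simp
qed

end

section \<open>Curvature around a large face\<close>

text \<open>A further face of degree at least 5 leaves at most 1/8 + 1/5 + 2/3 < 1, and two squares
  leave at most 1/8 + 1/2 + 1/3 < 1.\<close>

lemma vertex_with_large_face:
  fixes k x y t :: nat
  assumes "8 \<le> k" "3 \<le> x" "3 \<le> y" "3 \<le> t"
    and pos: "0 \<le> -1 + 1 / real k + 1 / real x + 1 / real y + 1 / real t"
  shows "(x, y, t) \<in> {(3, 3, 3), (4, 3, 3), (3, 4, 3), (3, 3, 4)}"
proof -
  have le: "1 / real n \<le> 1 / real m" if "m \<le> n" "0 < m" for m n :: nat
    using that by (simp add: frac_le)
  have k: "1 / real k \<le> 1 / 8" using le[of 8 k] assms(1) by simp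
  have le3: "1 / real n \<le> 1 / 3" if "3 \<le> n" for n :: nat using le[of 3 n] that by simp
  have le5: "1 / real n \<le> 1 / 5" if "\<not> n \<le> 4" for n :: nat using le[of 5 n] that by simp
  note 3 = le3[OF assms(2)] le3[OF assms(3)] le3[OF assms(4)]
  have x: "x \<le> 4" by (rule ccontr) (use le5[of x] k 3 pos in linarith)
  have y: "y \<le> 4" by (rule ccontr) (use le5[of y] k 3 pos in linarith)
  have t: "t \<le> 4" by (rule ccontr) (use le5[of t] k 3 pos in linarith)
  have 4: "1 / real n = 1 / 4" if "n = 4" for n :: nat using that by simp
  have xy: "\<not> (x = 4 \<and> y = 4)" using 4[of x] 4[of y] k 3 pos by linarith
  have xt: "\<not> (x = 4 \<and> t = 4)" using 4[of x] 4[of t] k 3 pos by linarith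
  have yt: "\<not> (y = 4 \<and> t = 4)" using 4[of y] 4[of t] k 3 pos by linarith
  have "x = 3 \<or> x = 4" "y = 3 \<or> y = 4" "t = 3 \<or> t = 4" using x y t assms by linarith+
  then show ?thesis using xy xt yt by auto
qed

context four_regular_complex
begin

text \<open>This is the gamma of the overview. The opposite face is singled out as the one sharing
  no side with \<open>\<sigma>\<close> at \<open>w\<close>, so the value depends on no chosen
  \<open>link\<close> and can be summed over vertices.\<close>

definition opposite_square :: "'f \<Rightarrow> 'v \<Rightarrow> real" where
  "opposite_square \<sigma> w =
     of_bool (\<exists>g\<in>F. w \<in> corners g \<and> sides_at g w \<inter> sides \<sigma> = {} \<and> card (sides g) = 4)"

lemma opposite_square_link:
  assumes l: "link w \<sigma> a b P c Q d R"
  shows "opposite_square \<sigma> w = of_bool (card (sides R) = 4)"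
proof -
  note D = linkD[OF l]
  have "sides_at \<sigma> w = {a, b}" using l unfolding link_def by simp
  then have cd: "c \<notin> sides \<sigma>" "d \<notin> sides \<sigma>" using D unfolding sides_at_def by auto
  have R: "sides_at R w = {c, d}" using l unfolding link_def by simp
  have "g \<in> F \<and> w \<in> corners g \<and> sides_at g w \<inter> sides \<sigma> = {} \<longleftrightarrow> g = R" for g
  proof
    assume g: "g \<in> F \<and> w \<in> corners g \<and> sides_at g w \<inter> sides \<sigma> = {}"
    then have "g \<in> {\<sigma>, P, Q, R}" using l unfolding link_def by (metis (no_types, lifting) mem_Collect_eq)
    moreover have "a \<in> sides_at \<sigma> w" "a \<in> sides_at P w" "b \<in> sides_at Q w"
      using D unfolding sides_at_def by auto
    ultimately show "g = R" using g D(13,14) by auto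
  next
    assume "g = R"
    then show "g \<in> F \<and> w \<in> corners g \<and> sides_at g w \<inter> sides \<sigma> = {}"
      using R cd D(4) ends_in_corners[OF D(19) D(11)] by auto
  qed
  then have "(g \<in> F \<and> w \<in> corners g \<and> sides_at g w \<inter> sides \<sigma> = {} \<and> card (sides g) = 4)
      = (g = R \<and> card (sides g) = 4)" for g by (simp only: conj_assoc[symmetric])
  then show ?thesis unfolding opposite_square_def Bex_def by simp
qed

lemma link_at_corner:
  assumes "\<sigma> \<in> F" "a \<in> sides \<sigma>" "u \<in> ends a" "P \<in> F" "a \<in> sides P" "P \<noteq> \<sigma>"
  obtains b c Q d R where "link u \<sigma> a b P c Q d R"
proof -
  obtain b where b: "b \<in> sides \<sigma>" "u \<in> ends b" "b \<noteq> a" using other_side assms(1-3) by metis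
  obtain Q where Q: "Q \<in> F" "b \<in> sides Q" "Q \<noteq> \<sigma>" using other_face assms(1) b(1) by metis
  obtain c d R where "link u \<sigma> a b P c Q d R"
    using link_exists[OF assms(1,2) b(1) b(3)[symmetric] assms(3) b(2) assms(4-6) Q] by metis
  then show ?thesis using that by blast
qed

lemma link_edge_unique:
  assumes "link v A a b P c Q d R"
  shows "e \<in> sides P \<Longrightarrow> v \<in> ends e \<Longrightarrow> e \<noteq> a \<Longrightarrow> e = c"
    and "e \<in> sides Q \<Longrightarrow> v \<in> ends e \<Longrightarrow> e \<noteq> b \<Longrightarrow> e = d"
proof -
  have "sides_at P v = {a, c}" "sides_at Q v = {b, d}" using assms unfolding link_def by simp_all
  then show "e \<in> sides P \<Longrightarrow> v \<in> ends e \<Longrightarrow> e \<noteq> a \<Longrightarrow> e = c"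
    and "e \<in> sides Q \<Longrightarrow> v \<in> ends e \<Longrightarrow> e \<noteq> b \<Longrightarrow> e = d"
    unfolding sides_at_def by auto
qed

text \<open>\<open>P\<close> and \<open>\<sigma>\<close> share the side \<open>a\<close>, so a
  common corner \<open>p\<close> would be an end of \<open>a\<close>; then \<open>a\<close> and
  \<open>c\<close> would have the same two ends. This places \<open>p\<close> in the outer boundary
  of the neighbourhood of \<open>\<sigma>\<close>.\<close>

lemma outer_end_not_corner:
  assumes l: "link z \<sigma> a b P c Q d R" and p: "ends c = {z, p}"
  shows "p \<notin> corners \<sigma>"
proof
  note D = linkD[OF l]
  assume "p \<in> corners \<sigma>"
  then obtain x where x: "x \<in> sides \<sigma>" "p \<in> ends x" unfolding corners_def by blast
  have ne: "P \<noteq> \<sigma>" using D(21) by auto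
  have "p \<in> ends c" using p by simp
  then have "p \<in> ends a" using common_side[OF D(2,1) ne D(15,13) D(16) _ x] by blast
  moreover have "z \<noteq> p" using p card_ends[OF D(7)] by auto
  ultimately have "a = c" using common_ends_unique[OF D(5,7) D(9) _ D(11)] \<open>p \<in> ends c\<close> by blast
  then show False using D(22) by auto
qed

end

section \<open>Curvature estimates at the corners of a large face\<close>

locale nonneg_four_regular_complex = four_regular_complex +
  assumes curv_nonneg: "v \<in> V \<Longrightarrow> 0 \<le> curv v"
begin

lemma link_vertex: "link z A a b P c Q d R \<Longrightarrow> z \<in> V"
  using linkD(5,9) ends_subset by blast

lemma link_curv_nonneg:
  assumes "link v A a b P c Q d R"
  shows "0 \<le> -1 + 1 / card (sides A) + 1 / card (sides P) + 1 / card (sides Q) + 1 / card (sides R)"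
  using curv_link[OF assms] curv_nonneg[OF link_vertex[OF assms]] by simp

lemma link_large:
  assumes "link z \<sigma> a b P c Q d R" "8 \<le> card (sides \<sigma>)"
  shows "(card (sides P), card (sides Q), card (sides R)) \<in> {(3, 3, 3), (4, 3, 3), (3, 4, 3), (3, 3, 4)}"
  using vertex_with_large_face[OF assms(2) _ _ _ link_curv_nonneg[OF assms(1)]]
    linkD(2-4)[OF assms(1)] card_sides by blast

lemma opposite_face_large:
  assumes "link z \<sigma> a b P c Q d R" "8 \<le> card (sides \<sigma>)"
  shows "1 / card (sides R) = 1 / 3 - opposite_square \<sigma> z / 12"
  using link_large[OF assms] opposite_square_link[OF assms(1)] by auto

text \<open>The triangle \<open>P\<close> has vertices \<open>z, u, p\<close>. Around
  \<open>p\<close> lie \<open>P\<close>, then \<open>R\<close> across \<open>c\<close>, the face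
  opposite to \<open>\<sigma>\<close> at \<open>u\<close> across the side \<open>up\<close>, and
  finally \<open>H\<close>. The face at \<open>u\<close> contributes 1/3 minus 1/12 of its
  gamma.\<close>

lemma curv_triangle_apex:
  assumes l: "link z \<sigma> a b P c Q d R" and P: "card (sides P) = 3" and k: "8 \<le> card (sides \<sigma>)"
    and p: "ends c = {z, p}" and u: "ends a = {z, u}"
    and h: "h \<in> sides R" "p \<in> ends h" "h \<noteq> c" and H: "H \<in> F" "h \<in> sides H" "H \<noteq> R"
  shows "curv p = - 1 / 3 + 1 / card (sides R) - opposite_square \<sigma> u / 12 + 1 / card (sides H)"
proof -
  note D = linkD[OF l]
  have ne: "P \<noteq> \<sigma>" "P \<noteq> R" "a \<noteq> c" using D(21,22) by auto
  obtain t where t: "t \<in> sides P" "t \<noteq> a" "t \<noteq> c" "ends t = {u, p}" "u \<noteq> p"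
    by (rule triangle[OF D(2) P D(15,16) ne(3) u p])
  obtain a2 c2 Q2 d2 R2 where l2: "link u \<sigma> a a2 P c2 Q2 d2 R2"
    using link_at_corner[OF D(1,13) _ D(2,15) ne(1)] u by (metis insertCI)
  note D2 = linkD[OF l2]
  have "t = c2" using link_edge_unique(1)[OF l2 t(1) _ t(2)] t(4) by blast
  then have tR2: "t \<in> sides R2" using D2(19) by simp
  have ne2: "R2 \<noteq> P" using D2(21) by auto
  have pc: "p \<in> ends c" "p \<in> ends t" using p t(4) by auto
  \<comment> \<open>The cyclic order at \<open>p\<close> is taken with the triangle \<open>P\<close>
    as base face; its neighbours across \<open>c\<close> and \<open>t\<close> are \<open>R\<close>
    and \<open>R2\<close>.\<close>
  obtain c3 d3 R3 where l3: "link p P c t R c3 R2 d3 R3"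
    using link_exists[OF D(2,16) t(1) t(3)[symmetric] pc D(4,19) ne(2)[symmetric] D2(4) tR2 ne2]
    by metis
  note D3 = linkD[OF l3]
  have "h = c3" using link_edge_unique(1)[OF l3 h(1,2,3)] .
  then have "h \<in> sides R3" using D3(19) by simp
  moreover have "R3 \<noteq> R" using D3(21) by auto
  ultimately have "H = R3" using faces_at_edge_cases[OF D(4) D3(4) H(1) h(1) _ H(2)] H(3) by blast
  then show ?thesis using curv_link[OF l3] P opposite_face_large[OF l2 k] by simp
qed

text \<open>Let \<open>w\<close> be the corner of the square \<open>R\<close> opposite to
  \<open>z\<close>, and \<open>H\<close>, \<open>H'\<close> the faces beyond the two sides at
  \<open>w\<close>. Non-negative curvature at \<open>w\<close> gives 1/|H| + 1/|H'| at least 1 - 1/4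
  - 1/3 = 5/12. Adding the formulas for the two triangle apexes yields -2/3 + 1/2 + 5/12 = 3/12
  before the gamma terms.\<close>

lemma opposite_square_case:
  assumes l: "link z \<sigma> a b P c Q d R" and k: "8 \<le> card (sides \<sigma>)" and R: "card (sides R) = 4"
    and p: "ends c = {z, p}" and q: "ends d = {z, q}"
    and u: "ends a = {z, u}" and u': "ends b = {z, u'}"
  shows "(3 - opposite_square \<sigma> u - opposite_square \<sigma> u') / 12 \<le> curv p + curv q"
proof -
  note D = linkD[OF l]
  have PQ: "card (sides P) = 3" "card (sides Q) = 3" using link_large[OF l k] R by auto
  have cd: "c \<noteq> d" using D(22) by auto
  obtain s t w where st: "s \<in> sides R" "t \<in> sides R" "s \<noteq> t" "s \<noteq> c" "t \<noteq> d"
    "ends s = {p, w}" "ends t = {q, w}"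
    by (rule quadrilateral[OF D(4) R D(19,20) cd p q])
  obtain H where H: "H \<in> F" "s \<in> sides H" "H \<noteq> R" using other_face[OF D(4) st(1)] by metis
  obtain H' where H': "H' \<in> F" "t \<in> sides H'" "H' \<noteq> R" using other_face[OF D(4) st(2)] by metis
  have w: "w \<in> ends s" "w \<in> ends t" using st by auto
  obtain x y X where lw: "link w R s t H x H' y X"
    using link_exists[OF D(4) st(1,2,3) w H H'] by metis
  have "3 \<le> card (sides X)" using card_sides linkD(4)[OF lw] by blast
  then have "1 / real (card (sides X)) \<le> 1 / 3" by (intro divide_left_mono) auto
  then have "5 / 12 \<le> 1 / real (card (sides H)) + 1 / real (card (sides H'))"
    using link_curv_nonneg[OF lw] R by simp
  moreover have "curv p = - 1 / 3 + 1 / card (sides R) - opposite_square \<sigma> u / 12 + 1 / card (sides H)"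
    using curv_triangle_apex[OF l PQ(1) k p u st(1) _ st(4) H] st(6) by simp
  moreover have "curv q = - 1 / 3 + 1 / card (sides R) - opposite_square \<sigma> u' / 12 + 1 / card (sides H')"
    using curv_triangle_apex[OF link_swap[OF l] PQ(2) k q u' st(2) _ st(5) H'] st(7) by simp
  ultimately show ?thesis using R by simp
qed

text \<open>Here \<open>R\<close> is a triangle \<open>z, p, q\<close> and \<open>H\<close> lies
  beyond its side \<open>pq\<close>. Non-negative curvature at \<open>q\<close>, a corner of the
  square \<open>Q\<close>, gives 1/|H| at least 1 - 1/3 - 1/4 - 1/3 = 1/12. This enters the
  curvature of \<open>p\<close>, while \<open>q\<close> contributes at least 0.\<close>

lemma adjacent_square_case:
  assumes l: "link z \<sigma> a b P c Q d R" and k: "8 \<le> card (sides \<sigma>)" and Q: "card (sides Q) = 4"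
    and p: "ends c = {z, p}" and q: "ends d = {z, q}" and u: "ends a = {z, u}"
  shows "(1 - opposite_square \<sigma> u) / 12 \<le> curv p + curv q"
proof -
  note D = linkD[OF l]
  have PR: "card (sides P) = 3" "card (sides R) = 3" using link_large[OF l k] Q by auto
  have ne: "c \<noteq> d" "Q \<noteq> R" using D(21,22) by auto
  obtain h where h: "h \<in> sides R" "h \<noteq> c" "h \<noteq> d" "ends h = {p, q}" "p \<noteq> q"
    by (rule triangle[OF D(4) PR(2) D(19,20) ne(1) p q])
  obtain H where H: "H \<in> F" "h \<in> sides H" "H \<noteq> R" using other_face[OF D(4) h(1)] by metis
  have q': "q \<in> ends d" "q \<in> ends h" using q h by auto
  obtain x y X where lq: "link q R d h Q x H y X"
    using link_exists[OF D(4,20) h(1) h(3)[symmetric] q' D(3,18) ne(2) H] by metis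
  have "3 \<le> card (sides X)" using card_sides linkD(4)[OF lq] by blast
  then have "1 / real (card (sides X)) \<le> 1 / 3" by (intro divide_left_mono) auto
  then have "1 / 12 \<le> 1 / real (card (sides H))"
    using link_curv_nonneg[OF lq] PR Q by simp
  moreover have "curv p = - 1 / 3 + 1 / card (sides R) - opposite_square \<sigma> u / 12 + 1 / card (sides H)"
    using curv_triangle_apex[OF l PR(1) k p u h(1) _ h(2) H] h(4) by simp
  moreover have "0 \<le> curv q" using curv_nonneg[OF link_vertex[OF lq]] .
  ultimately show ?thesis using PR by simp
qed

text \<open>A square costs 1/12 in \<open>curv z\<close>, which half of the outer curvature partly
  or fully repays. An opposite square meets the bound by the apex estimate alone; an adjacent one
  also discards the nonnegative gamma of one neighbour. With triangles only, \<open>curv z\<close>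
  alone suffices.\<close>

lemma link_curvature_bound:
  assumes l: "link z \<sigma> a b P c Q d R" and k: "8 \<le> card (sides \<sigma>)"
    and p: "ends c = {z, p}" and q: "ends d = {z, q}"
    and u: "ends a = {z, u}" and u': "ends b = {z, u'}"
  shows "1 / card (sides \<sigma>) - 1 / 24
      + (2 * opposite_square \<sigma> z - opposite_square \<sigma> u - opposite_square \<sigma> u') / 24
    \<le> curv z + (curv p + curv q) / 2"
proof -
  note D = linkD[OF l]
  have nn: "0 \<le> opposite_square \<sigma> x" for x unfolding opposite_square_def by simp
  have "p \<in> V" "q \<in> V" using D(7,8) p q ends_subset by blast+
  then have pq: "0 \<le> curv p" "0 \<le> curv q" using curv_nonneg by auto
  have z: "opposite_square \<sigma> z = of_bool (card (sides R) = 4)" using opposite_square_link[OF l] .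
  consider "card (sides R) = 4" "card (sides P) = 3" "card (sides Q) = 3"
    | "card (sides Q) = 4" "card (sides P) = 3" "card (sides R) = 3"
    | "card (sides P) = 4" "card (sides Q) = 3" "card (sides R) = 3"
    | "card (sides P) = 3" "card (sides Q) = 3" "card (sides R) = 3"
    using link_large[OF l k] by auto
  then show ?thesis
  proof cases
    case 1
    then show ?thesis
      using opposite_square_case[OF l k 1(1) p q u u'] curv_link[OF l] z by (simp add: field_simps)
  next
    case 2
    then show ?thesis
      using adjacent_square_case[OF l k 2(1) p q u] curv_link[OF l] z nn[of u'] by (simp add: field_simps)
  next
    case 3
    then show ?thesis
      using adjacent_square_case[OF link_swap[OF l] k 3(1) q p u'] curv_link[OF l] z nn[of u]
      by (simp add: field_simps)
  next
    case 4
    then show ?thesis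
      using curv_link[OF l] z nn[of u] nn[of u'] pq by (simp add: field_simps)
  qed
qed

text \<open>For a side with ends \<open>z\<close> and \<open>u\<close> the summand equals the gamma
  of \<open>z\<close> minus that of \<open>u\<close>. Summing over incident sides allows an exchange
  of summation later, without enumerating the boundary cyclically.\<close>

lemma corner_curvature_bound:
  assumes \<sigma>: "\<sigma> \<in> F" and k: "8 \<le> card (sides \<sigma>)" and z: "z \<in> corners \<sigma>"
  obtains c d p q where "c \<in> E" "d \<in> E" "ends c = {z, p}" "ends d = {z, q}" "p \<noteq> q"
    "p \<notin> corners \<sigma>" "q \<notin> corners \<sigma>"
    "1 / card (sides \<sigma>) - 1 / 24
      + (\<Sum>e\<in>sides_at \<sigma> z. 2 * opposite_square \<sigma> z - (\<Sum>v\<in>ends e. opposite_square \<sigma> v)) / 24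
    \<le> curv z + (curv p + curv q) / 2"
proof -
  obtain a where a: "a \<in> sides \<sigma>" "z \<in> ends a" using z unfolding corners_def by blast
  obtain P where P: "P \<in> F" "a \<in> sides P" "P \<noteq> \<sigma>" using other_face \<sigma> a(1) by metis
  obtain b c Q d R where l: "link z \<sigma> a b P c Q d R" using link_at_corner[OF \<sigma> a P] by metis
  note D = linkD[OF l]
  obtain p where p: "ends c = {z, p}" "z \<noteq> p" using other_end[OF D(7,11)] by metis
  obtain q where q: "ends d = {z, q}" "z \<noteq> q" using other_end[OF D(8,12)] by metis
  obtain u where u: "ends a = {z, u}" "z \<noteq> u" using other_end[OF D(5,9)] by metis
  obtain u' where u': "ends b = {z, u'}" "z \<noteq> u'" using other_end[OF D(6,10)] by metis
  have "sides_at \<sigma> z = {a, b}" using l unfolding link_def by simp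
  moreover have "a \<noteq> b" "c \<noteq> d" using D(22) by auto
  ultimately have "(\<Sum>e\<in>sides_at \<sigma> z. 2 * opposite_square \<sigma> z - (\<Sum>v\<in>ends e. opposite_square \<sigma> v))
      = 2 * opposite_square \<sigma> z - opposite_square \<sigma> u - opposite_square \<sigma> u'"
    using u u' by simp
  moreover have "p \<noteq> q" using ends_inject[OF D(7,8)] p q \<open>c \<noteq> d\<close> by auto
  ultimately show ?thesis
    using that[OF D(7,8) p(1) q(1)] outer_end_not_corner[OF l p(1)]
      outer_end_not_corner[OF link_swap[OF l] q(1)]
      link_curvature_bound[OF l k p(1) q(1) u(1) u'(1)] by presburger
qed

text \<open>The transfers of \<open>1/24\<close> along the sides of \<open>\<sigma>\<close> are antisymmetric in the two ends of a side.\<close>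

lemma sum_transfers_eq_0:
  fixes g :: "'a \<Rightarrow> real"
  assumes \<sigma>: "\<sigma> \<in> F"
  shows "(\<Sum>z\<in>corners \<sigma>. \<Sum>e\<in>sides_at \<sigma> z. 2 * g z - (\<Sum>v\<in>ends e. g v)) = 0"
proof -
  have "(\<Sum>z\<in>corners \<sigma>. \<Sum>e\<in>sides_at \<sigma> z. 2 * g z - (\<Sum>v\<in>ends e. g v))
      = (\<Sum>e\<in>sides \<sigma>. \<Sum>z | z \<in> corners \<sigma> \<and> z \<in> ends e. 2 * g z - (\<Sum>v\<in>ends e. g v))"
    unfolding sides_at_def
    using sum.swap_restrict[OF finite_corners[OF \<sigma>] finite_sides[OF \<sigma>]] by fast
  also have "\<dots> = (\<Sum>e\<in>sides \<sigma>. 0)"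
  proof (rule sum.cong)
    fix e assume e: "e \<in> sides \<sigma>"
    then have "{z. z \<in> corners \<sigma> \<and> z \<in> ends e} = ends e" unfolding corners_def by blast
    moreover have "card (ends e) = 2" using card_ends sides_in_E \<sigma> e by blast
    ultimately show "(\<Sum>z | z \<in> corners \<sigma> \<and> z \<in> ends e. 2 * g z - (\<Sum>v\<in>ends e. g v)) = 0"
      by (simp add: sum_subtractf sum_distrib_left[symmetric])
  qed simp
  finally show ?thesis by simp
qed

text \<open>The weight \<open>m\<close> stands for the modified curvature, of which only the lower
  bound through two outer neighbours enters. Once the transfers cancel, the k corners contribute 1/k
  - 1/24 each.\<close>

theorem modified_curvature_sum_bound:
  assumes \<sigma>: "\<sigma> \<in> F" and k: "8 \<le> card (sides \<sigma>)"
    and m: "\<And>z c d p q. z \<in> corners \<sigma> \<Longrightarrow> c \<in> E \<Longrightarrow> d \<in> E \<Longrightarrow> ends c = {z, p} \<Longrightarrow> ends d = {z, q} \<Longrightarrow>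
      p \<noteq> q \<Longrightarrow> p \<notin> corners \<sigma> \<Longrightarrow> q \<notin> corners \<sigma> \<Longrightarrow> curv z + (curv p + curv q) / 2 \<le> m z"
  shows "1 - card (sides \<sigma>) / 24 \<le> (\<Sum>z\<in>corners \<sigma>. m z)"
proof -
  define g where "g = opposite_square \<sigma>"
  define n where "n = card (sides \<sigma>)"
  have "1 - real n / 24 = (\<Sum>z\<in>corners \<sigma>. 1 / real n - 1 / 24)"
    using card_corners[OF \<sigma>] k unfolding n_def by (simp add: field_simps)
  also have "\<dots> = (\<Sum>z\<in>corners \<sigma>. 1 / real n - 1 / 24
      + (\<Sum>e\<in>sides_at \<sigma> z. 2 * g z - (\<Sum>v\<in>ends e. g v)) / 24)"
    unfolding sum.distrib sum_divide_distrib[symmetric] sum_transfers_eq_0[OF \<sigma>] by simp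
  also have "\<dots> \<le> (\<Sum>z\<in>corners \<sigma>. m z)"
  proof (rule sum_mono)
    fix z assume z: "z \<in> corners \<sigma>"
    obtain c d p q where *: "c \<in> E" "d \<in> E" "ends c = {z, p}" "ends d = {z, q}" "p \<noteq> q"
      "p \<notin> corners \<sigma>" "q \<notin> corners \<sigma>" and
      le: "1 / real n - 1 / 24 + (\<Sum>e\<in>sides_at \<sigma> z. 2 * g z - (\<Sum>v\<in>ends e. g v)) / 24
        \<le> curv z + (curv p + curv q) / 2"
      unfolding n_def g_def by (rule corner_curvature_bound[OF \<sigma> k z]) blast
    show "1 / real n - 1 / 24 + (\<Sum>e\<in>sides_at \<sigma> z. 2 * g z - (\<Sum>v\<in>ends e. g v)) / 24 \<le> m z"
      using order_trans[OF le m[OF z *]] .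
  qed
  finally show ?thesis unfolding n_def .
qed

end

section \<open>Circles composed of arcs\<close>

lemma homeomorphism_circle_minus_point:
  fixes C :: "(real^2) set"
  assumes "C homeomorphic sphere (0::real^2) 1" "v \<in> C"
  obtains \<phi> \<psi> where "homeomorphism (C - {v}) (UNIV::real set) \<phi> \<psi>"
proof -
  obtain f g where fg: "homeomorphism C (sphere (0::real^2) 1) f g"
    using assms(1) unfolding homeomorphic_def by blast
  have fv: "f v \<in> sphere 0 1" using fg assms(2) unfolding homeomorphism_def by blast
  have inj: "inj_on f C" using homeomorphism_apply1[OF fg] by (rule inj_on_inverseI)
  have "f ` (C - {v}) = sphere 0 1 - {f v}"
    using inj_on_image_set_diff[OF inj, of C "{v}"] fg assms(2) unfolding homeomorphism_def by auto
  then have "homeomorphism (C - {v}) (sphere 0 1 - {f v}) f g"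
    by (rule homeomorphism_of_subsets[OF fg Diff_subset order_refl])
  then have "(C - {v}) homeomorphic (sphere 0 1 - {f v})" unfolding homeomorphic_def by blast
  also have "(sphere 0 1 - {f v}) homeomorphic (UNIV::real set)"
    using fv by (intro homeomorphic_punctured_sphere_affine) auto
  finally show ?thesis using that unfolding homeomorphic_def by blast
qed

lemma connected_arc_minus_end:
  assumes "arc g" "v \<in> {pathstart g, pathfinish g}"
  shows "connected (path_image g - {v})"
proof -
  have start: "connected (path_image h - {pathstart h})" if h: "arc h" for h :: "real \<Rightarrow> 'a"
  proof -
    have inj: "inj_on h {0..1}" and cont: "continuous_on {0..1} h"
      using h unfolding arc_def path_def by auto
    have "path_image h - {pathstart h} = h ` ({0..1} - {0})"
      using inj_on_image_set_diff[OF inj, of "{0..1}" "{0}"] unfolding path_image_def pathstart_def by auto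
    also have "{0..1} - {0} = {0<..1::real}" by auto
    finally have "path_image h - {pathstart h} = h ` {0<..1}" .
    moreover have "connected (h ` {0<..1})"
      by (intro connected_continuous_image continuous_on_subset[OF cont]) auto
    ultimately show ?thesis by simp
  qed
  show ?thesis
    using start[OF assms(1)] start[OF arc_reversepath[OF assms(1)]] assms(2) by auto
qed

lemma arc_image_infinite: "arc g \<Longrightarrow> infinite (path_image g)"
  unfolding arc_def path_image_def by (simp add: finite_image_iff)

lemma islimpt_arc:
  fixes g :: "real \<Rightarrow> 'a::metric_space"
  assumes "arc g" "v \<in> path_image g"
  shows "v islimpt path_image g"
  using connected_imp_perfect[OF connected_arc_image[OF assms(1)] assms(2)] arc_image_infinite[OF assms(1)]
  by (metis finite.emptyI finite_insert)

text \<open>Removing \<open>v\<close> turns the circle into a line and the arcs into intervals,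
  unbounded exactly for the arcs through \<open>v\<close>. Finitely many intervals cover the line,
  so some is unbounded above and some below; each is unique because two sharing a ray would overlap
  infinitely.\<close>

lemma circle_two_arcs_at_point:
  fixes C :: "(real^2) set"
  assumes C: "C homeomorphic sphere (0::real^2) 1" and B: "finite B" "\<Union>B = C" and v: "v \<in> C"
    and arcs: "\<And>e. e \<in> B \<Longrightarrow> \<exists>g. arc g \<and> path_image g = e \<and> (v \<in> e \<longrightarrow> v \<in> {pathstart g, pathfinish g})"
    and meet: "\<And>e e'. e \<in> B \<Longrightarrow> e' \<in> B \<Longrightarrow> e \<noteq> e' \<Longrightarrow> finite (e \<inter> e')"
  shows "card {e \<in> B. v \<in> e} = 2"
proof -
  obtain \<phi> \<psi> where h: "homeomorphism (C - {v}) (UNIV::real set) \<phi> \<psi>"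
    using homeomorphism_circle_minus_point[OF C v] by blast
  have \<psi>\<phi>: "\<psi> (\<phi> x) = x" if "x \<in> C - {v}" for x using h that unfolding homeomorphism_def by blast
  have \<phi>\<psi>: "\<phi> (\<psi> y) = y" for y using h unfolding homeomorphism_def by blast
  have \<psi>C: "\<psi> y \<in> C - {v}" for y using h unfolding homeomorphism_def by blast
  have cont\<phi>: "continuous_on (C - {v}) \<phi>" and cont\<psi>: "continuous_on UNIV \<psi>"
    using h unfolding homeomorphism_def by auto
  define I where "I e = \<phi> ` (e - {v})" for e
  have sub: "e - {v} \<subseteq> C - {v}" if "e \<in> B" for e using that B by blast
  have \<psi>I: "\<psi> ` I e = e - {v}" if "e \<in> B" for e
    unfolding I_def image_image using sub[OF that] \<psi>\<phi> by force
  \<comment> \<open>A bounded image would have compact closure, so \<open>e - {v}\<close> would lie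
    in a closed set avoiding \<open>v\<close>, although \<open>v\<close> is one of its limit
    points.\<close>
  have unb: "\<not> bounded (I e)" if e: "e \<in> B" "v \<in> e" for e
  proof
    assume "bounded (I e)"
    then have "compact (closure (I e))" by simp
    then have "compact (\<psi> ` closure (I e))"
      using compact_continuous_image continuous_on_subset[OF cont\<psi>] by blast
    then have cl: "closed (\<psi> ` closure (I e))" by (rule compact_imp_closed)
    have "e - {v} \<subseteq> \<psi> ` closure (I e)" using \<psi>I[OF e(1)] closure_subset by blast
    then have "closure (e - {v}) \<subseteq> \<psi> ` closure (I e)" using cl closure_minimal by blast
    moreover have "v \<in> closure (e - {v})"
      using arcs[OF e(1)] islimpt_arc e(2) by (metis islimpt_in_closure)
    ultimately show False using \<psi>C by blast
  qed
  have conn: "connected (I e)" if e: "e \<in> B" for e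
  proof -
    obtain g where g: "arc g" "path_image g = e" "v \<in> e \<longrightarrow> v \<in> {pathstart g, pathfinish g}"
      using arcs[OF e] by blast
    have "connected (e - {v})"
      using connected_arc_minus_end[OF g(1)] g connected_arc_image[OF g(1)] by (cases "v \<in> e") auto
    then show ?thesis
      unfolding I_def using connected_continuous_image continuous_on_subset[OF cont\<phi> sub[OF e]] by blast
  qed
  have bnd: "bounded (I e)" if e: "e \<in> B" "v \<notin> e" for e
  proof -
    have "compact e" using arcs[OF e(1)] compact_arc_image by blast
    moreover have "e - {v} = e" using e by blast
    ultimately have "compact (I e)"
      unfolding I_def using compact_continuous_image continuous_on_subset[OF cont\<phi> sub[OF e(1)]] by metis
    then show ?thesis by (rule compact_imp_bounded)
  qed
  have ray_up: "\<exists>m. {m..} \<subseteq> I e" if e: "e \<in> B" "\<not> bdd_above (I e)" for e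
  proof -
    have "I e \<noteq> {}" using e(2) by auto
    then obtain m where m: "m \<in> I e" by blast
    have "{m..} \<subseteq> I e"
    proof
      fix x assume x: "x \<in> {m..}"
      obtain y where "y \<in> I e" "x \<le> y" using e(2) unfolding bdd_above_def by (meson linear)
      then show "x \<in> I e" using connectedD_interval[OF conn[OF e(1)] m] x by auto
    qed
    then show ?thesis by blast
  qed
  have ray_down: "\<exists>m. {..m} \<subseteq> I e" if e: "e \<in> B" "\<not> bdd_below (I e)" for e
  proof -
    have "I e \<noteq> {}" using e(2) by auto
    then obtain m where m: "m \<in> I e" by blast
    have "{..m} \<subseteq> I e"
    proof
      fix x assume x: "x \<in> {..m}"
      obtain y where "y \<in> I e" "y \<le> x" using e(2) unfolding bdd_below_def by (meson linear)
      then show "x \<in> I e" using connectedD_interval[OF conn[OF e(1)] _ m] x by auto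
    qed
    then show ?thesis by blast
  qed
  have same: "e = e'" if e: "e \<in> B" "e' \<in> B" and inf: "infinite (I e \<inter> I e')" for e e'
  proof (rule ccontr)
    assume "e \<noteq> e'"
    then have "finite (e \<inter> e')" using meet e by blast
    moreover have "\<psi> ` (I e \<inter> I e') \<subseteq> e \<inter> e'" using \<psi>I e by blast
    ultimately have "finite (\<psi> ` (I e \<inter> I e'))" using finite_subset by blast
    moreover have "inj_on \<psi> (I e \<inter> I e')" using \<phi>\<psi> by (rule inj_on_inverseI)
    ultimately show False using inf finite_imageD by blast
  qed
  have same_up: "e = e'" if e: "e \<in> B" "e' \<in> B" "\<not> bdd_above (I e)" "\<not> bdd_above (I e')" for e e'
  proof -
    obtain m m' where m: "{m..} \<subseteq> I e" "{m'..} \<subseteq> I e'" using ray_up e by meson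
    then have "{max m m'..} \<subseteq> I e \<inter> I e'" by force
    then show ?thesis using same[OF e(1,2)] infinite_Ici infinite_super by blast
  qed
  have same_down: "e = e'" if e: "e \<in> B" "e' \<in> B" "\<not> bdd_below (I e)" "\<not> bdd_below (I e')" for e e'
  proof -
    obtain m m' where m: "{..m} \<subseteq> I e" "{..m'} \<subseteq> I e'" using ray_down e by meson
    then have "{..min m m'} \<subseteq> I e \<inter> I e'" by force
    then show ?thesis using same[OF e(1,2)] infinite_Iic infinite_super by blast
  qed
  have cover: "(\<Union>e\<in>B. I e) = UNIV"
  proof -
    have "y \<in> (\<Union>e\<in>B. I e)" for y
    proof -
      obtain e where "e \<in> B" "\<psi> y \<in> e - {v}" using \<psi>C[of y] B by blast
      then show ?thesis unfolding I_def using \<phi>\<psi> by (metis UN_I imageI)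
    qed
    then show ?thesis by blast
  qed
  have "\<not> bdd_above (UNIV::real set)" "\<not> bdd_below (UNIV::real set)"
    unfolding bdd_above_def bdd_below_def by (meson UNIV_I gt_ex lt_ex not_le)+
  note nbdd = this
  obtain e1 where e1: "e1 \<in> B" "\<not> bdd_above (I e1)"
    using cover bdd_above_UN[OF B(1), of I] nbdd by auto
  obtain e2 where e2: "e2 \<in> B" "\<not> bdd_below (I e2)"
    using cover bdd_below_UN[OF B(1), of I] nbdd by auto
  have bb: "bounded S \<longleftrightarrow> bdd_above S \<and> bdd_below S" for S :: "real set"
    by (metis bdd_above.unfold bdd_below.unfold bounded_imp_bdd_above bounded_imp_bdd_below
        bounded_closed_interval bounded_subset atLeastAtMost_iff subsetI)
  have v12: "v \<in> e1" "v \<in> e2" using bnd[OF e1(1)] bnd[OF e2(1)] e1(2) e2(2) bb by auto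
  \<comment> \<open>An interval unbounded in both directions is the whole line, so a single arc
    would be the whole circle; but a circle separates the plane and an arc does not.\<close>
  have "e1 \<noteq> e2"
  proof
    assume eq: "e1 = e2"
    have "y \<in> I e1" for y
    proof -
      obtain a where "a \<in> I e1" "y \<le> a" using e1(2) unfolding bdd_above_def by (meson linear)
      moreover obtain b where "b \<in> I e1" "b \<le> y" using e2(2) unfolding eq bdd_below_def by (meson linear)
      ultimately show ?thesis using connectedD_interval[OF conn[OF e1(1)]] by blast
    qed
    then have "I e1 = UNIV" by blast
    then have "e1 - {v} = C - {v}" using \<psi>I[OF e1(1)] h unfolding homeomorphism_def by metis
    then have "e1 = C" using v v12 by blast
    then have "connected (- C)" using arcs[OF e1(1)] connected_arc_complement by fastforce
    then show False using Jordan_Brouwer_separation[OF C] by simp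
  qed
  moreover have "e \<in> {e1, e2}" if e: "e \<in> B" "v \<in> e" for e
  proof -
    have "\<not> bdd_above (I e) \<or> \<not> bdd_below (I e)" using unb[OF e] bb by simp
    then show ?thesis
      using same_up[OF e(1) e1(1) _ e1(2)] same_down[OF e(1) e2(1) _ e2(2)] by auto
  qed
  then have "{e \<in> B. v \<in> e} = {e1, e2}" using e1(1) e2(1) v12 by auto
  ultimately show ?thesis by simp
qed

section \<open>Planar tessellations\<close>

locale planar_tessellation =
  fixes V :: "(real^2) set" and E :: "(real^2) set set"
  assumes tess: "infinite_planar_tessellation V E"
begin

definition face_sides :: "(real^2) set \<Rightarrow> (real^2) set set" where
  "face_sides \<sigma> = {e \<in> E. e \<subseteq> frontier (closure \<sigma>)}"

section \<open>Edges as arcs\<close>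

lemma edge_arc:
  assumes "e \<in> E"
  obtains g where "arc g" "path_image g = e" "e \<inter> V = {pathstart g, pathfinish g}"
  using tess assms
  unfolding infinite_planar_tessellation_def simple_plane_graph_def plane_graph_def by meson

lemma edges_meet: "e \<in> E \<Longrightarrow> e' \<in> E \<Longrightarrow> e \<noteq> e' \<Longrightarrow> e \<inter> e' \<subseteq> V"
  using tess unfolding infinite_planar_tessellation_def simple_plane_graph_def plane_graph_def by meson

lemma edge_infinite: "e \<in> E \<Longrightarrow> infinite e"
  using edge_arc arc_image_infinite by metis

lemma card_edge_ends: "e \<in> E \<Longrightarrow> card (e \<inter> V) = 2"
  by (erule edge_arc) (use arc_distinct_ends in force)

lemma finite_edge_ends: "e \<in> E \<Longrightarrow> finite (e \<inter> V)"
  using card_edge_ends by (intro card_ge_0_finite) simp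

lemma finite_edges_meet: "e \<in> E \<Longrightarrow> e' \<in> E \<Longrightarrow> e \<noteq> e' \<Longrightarrow> finite (e \<inter> e')"
  using edges_meet[of e e'] finite_edge_ends[of e] by (meson finite_subset inf.bounded_iff inf_le1)

lemma edge_subset_eq: "e \<in> E \<Longrightarrow> e' \<in> E \<Longrightarrow> e \<subseteq> e' \<Longrightarrow> e = e'"
  using finite_edges_meet[of e e'] edge_infinite[of e] by (metis inf.absorb1)

lemma connected_open_edge:
  assumes "e \<in> E" shows "connected (e - V)"
proof -
  obtain g where g: "arc g" "path_image g = e" "e \<inter> V = {pathstart g, pathfinish g}"
    using edge_arc[OF assms] .
  then have "e - V = path_image g - {pathstart g, pathfinish g}" by blast
  then show ?thesis using connected_simple_path_endless[OF arc_imp_simple_path[OF g(1)]] by simp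
qed

lemma edge_subset_closure:
  assumes "e \<in> E" shows "e \<subseteq> closure (e - V)"
proof
  fix x assume x: "x \<in> e"
  obtain g where g: "arc g" "path_image g = e" using edge_arc[OF assms] .
  then have "x islimpt e" using islimpt_arc x by blast
  moreover have "e = (e \<inter> V) \<union> (e - V)" by blast
  ultimately have "x islimpt ((e \<inter> V) \<union> (e - V))" by simp
  then have "x islimpt (e - V)" by (simp only: islimpt_Un_finite[OF finite_edge_ends[OF assms]])
  then show "x \<in> closure (e - V)" by (simp add: closure_def)
qed

lemma closed_face:
  assumes "D \<in> closed_faces V E"
  shows "D homeomorphic cball (0::real^2) 1" "\<exists>B\<subseteq>E. finite B \<and> frontier D = \<Union>B"
  using tess assms unfolding infinite_planar_tessellation_def by simp_all

lemma closure_face: "\<sigma> \<in> faces V E \<Longrightarrow> closure \<sigma> \<in> closed_faces V E"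
  unfolding closed_faces_def by (rule imageI)

text \<open>The boundary set \<open>B\<close> supplied by axiom (i) must contain every edge in the
  frontier: an edge outside \<open>B\<close> meets each member of \<open>B\<close> in finitely many
  points, so the finite family \<open>B\<close> cannot cover it.\<close>

lemma frontier_face:
  assumes "\<sigma> \<in> faces V E"
  shows "finite (face_sides \<sigma>)" "frontier (closure \<sigma>) = \<Union>(face_sides \<sigma>)"
proof -
  obtain B where B: "B \<subseteq> E" "finite B" "frontier (closure \<sigma>) = \<Union>B"
    using closed_face(2)[OF closure_face[OF assms]] by metis
  have "face_sides \<sigma> \<subseteq> B"
  proof
    fix e assume "e \<in> face_sides \<sigma>"
    then have e: "e \<in> E" "e \<subseteq> \<Union>B" using B unfolding face_sides_def by auto
    show "e \<in> B"
    proof (rule ccontr)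
      assume "e \<notin> B"
      then have "finite (e \<inter> b)" if "b \<in> B" for b using finite_edges_meet[of e b] e B that by blast
      then have "finite (\<Union>b\<in>B. e \<inter> b)" using B(2) by blast
      moreover have "e = (\<Union>b\<in>B. e \<inter> b)" using e by blast
      ultimately show False using edge_infinite[OF e(1)] by simp
    qed
  qed
  moreover have "B \<subseteq> face_sides \<sigma>" using B unfolding face_sides_def by blast
  ultimately have "face_sides \<sigma> = B" by blast
  then show "finite (face_sides \<sigma>)" "frontier (closure \<sigma>) = \<Union>(face_sides \<sigma>)" using B by auto
qed

section \<open>Faces, their closures and their boundary circles\<close>

lemma face_disjoint_graph: "\<sigma> \<in> faces V E \<Longrightarrow> \<sigma> \<inter> (V \<union> \<Union>E) = {}"
  unfolding faces_def using in_components_subset by blast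

lemma face_nonempty: "\<sigma> \<in> faces V E \<Longrightarrow> \<sigma> \<noteq> {}"
  unfolding faces_def using in_components_nonempty by blast

text \<open>The intersection contains an infinite set, which leaves only the edge case of axiom
  (iii); an edge contained in another edge equals it.\<close>

lemma faces_meet_edge:
  assumes "\<sigma> \<in> faces V E" "\<sigma>' \<in> faces V E" "e \<in> E" "e \<subseteq> closure \<sigma>" "e \<subseteq> closure \<sigma>'"
    "closure \<sigma> \<noteq> closure \<sigma>'"
  shows "closure \<sigma> \<inter> closure \<sigma>' = e"
proof -
  have "closure \<sigma> \<in> closed_faces V E" "closure \<sigma>' \<in> closed_faces V E"
    using assms unfolding closed_faces_def by auto
  then have "closure \<sigma> \<inter> closure \<sigma>' = {} \<or> (\<exists>v\<in>V. closure \<sigma> \<inter> closure \<sigma>' = {v})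
      \<or> (\<exists>e\<in>E. closure \<sigma> \<inter> closure \<sigma>' = e)"
    using tess assms(6) unfolding infinite_planar_tessellation_def by meson
  moreover have sub: "e \<subseteq> closure \<sigma> \<inter> closure \<sigma>'" using assms(4,5) by blast
  moreover have "infinite (closure \<sigma> \<inter> closure \<sigma>')"
    using edge_infinite[OF assms(3)] sub infinite_super by blast
  ultimately obtain e' where "e' \<in> E" "closure \<sigma> \<inter> closure \<sigma>' = e'" by fastforce
  then show ?thesis using edge_subset_eq[OF assms(3)] sub by blast
qed

text \<open>An edge entering the interior of a closed face \<open>D\<close> would lie in \<open>D\<close>, hence be the intersection of
  \<open>D\<close> with a second closed face \<open>D'\<close>; but then the face dense in \<open>D'\<close> avoids a neighbourhood of
  an inner point of the edge.\<close>

lemma edge_disjoint_interior: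
  assumes \<sigma>: "\<sigma> \<in> faces V E" and e: "e \<in> E"
  shows "e \<inter> interior (closure \<sigma>) = {}"
proof (rule ccontr)
  let ?D = "closure \<sigma>"
  assume ne: "e \<inter> interior ?D \<noteq> {}"
  have fr: "frontier ?D \<inter> interior ?D = {}" by (simp add: frontier_def) blast
  have "e \<notin> face_sides \<sigma>" using ne fr unfolding face_sides_def by blast
  \<comment> \<open>Distinct edges meet only in \<open>V\<close>, so the open edge misses the
    frontier. As it is connected and meets the closed face, it stays inside.\<close>
  then have avoid: "(e - V) \<inter> frontier ?D = {}"
    unfolding frontier_face(2)[OF \<sigma>] using edges_meet[OF e] unfolding face_sides_def by blast
  have "closure (e - V) \<inter> interior ?D \<noteq> {}" using ne edge_subset_closure[OF e] by blast
  then have meets: "(e - V) \<inter> interior ?D \<noteq> {}"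
    using open_Int_closure_eq_empty[OF open_interior] by blast
  have "(e - V) \<inter> ?D \<noteq> {}" using meets interior_subset[of ?D] by blast
  then have "(e - V) - ?D = {}"
    using connected_Int_frontier[OF connected_open_edge[OF e], of ?D] avoid by argo
  then have sub: "e - V \<subseteq> ?D" by blast
  then have eD: "e \<subseteq> ?D" using edge_subset_closure[OF e] closure_minimal[of "e - V" ?D] by auto
  have "card {D \<in> closed_faces V E. e \<subseteq> D} = 2"
    using tess e unfolding infinite_planar_tessellation_def by meson
  then obtain A A' where A: "{D \<in> closed_faces V E. e \<subseteq> D} = {A, A'}" "A \<noteq> A'" by (meson card_2_iff)
  have "?D \<in> {D \<in> closed_faces V E. e \<subseteq> D}" using eD \<sigma> unfolding closed_faces_def by blast
  then have "\<exists>D'. D' \<in> {A, A'} \<and> D' \<noteq> ?D" using A by auto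
  then obtain D' where "D' \<in> {D \<in> closed_faces V E. e \<subseteq> D}" "D' \<noteq> ?D" unfolding A by blast
  then obtain \<sigma>' where \<sigma>': "\<sigma>' \<in> faces V E" "e \<subseteq> closure \<sigma>'" "closure \<sigma>' \<noteq> ?D"
    unfolding closed_faces_def by blast
  have int: "?D \<inter> closure \<sigma>' = e" using faces_meet_edge[OF \<sigma> \<sigma>'(1) e eD \<sigma>'(2)] \<sigma>'(3) by blast
  have "interior ?D \<inter> \<sigma>' \<subseteq> e" using int interior_subset[of ?D] closure_subset[of \<sigma>'] by blast
  then have "interior ?D \<inter> \<sigma>' = {}" using face_disjoint_graph[OF \<sigma>'(1)] e by blast
  then have "interior ?D \<inter> closure \<sigma>' = {}" using open_Int_closure_eq_empty[OF open_interior] by blast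
  then show False using ne \<sigma>'(2) by blast
qed

lemma graph_disjoint_interior:
  assumes \<sigma>: "\<sigma> \<in> faces V E"
  shows "interior (closure \<sigma>) \<inter> (V \<union> \<Union>E) = {}"
proof -
  have "V \<subseteq> \<Union>E"
  proof
    fix x assume "x \<in> V"
    then have "3 \<le> vertex_degree E x" using tess unfolding infinite_planar_tessellation_def by simp
    then have "{e \<in> E. x \<in> e} \<noteq> {}" unfolding vertex_degree_def by (intro notI) simp
    then show "x \<in> \<Union>E" by blast
  qed
  then show ?thesis using edge_disjoint_interior[OF \<sigma>] by blast
qed

text \<open>The closed face is a disk, so its interior is homeomorphic to an open disk and hence
  connected. It avoids the graph and meets \<open>\<sigma>\<close>, so it lies in that
  component.\<close>

lemma face_eq_interior:
  assumes \<sigma>: "\<sigma> \<in> faces V E"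
  shows "\<sigma> = interior (closure \<sigma>)"
proof
  have "\<sigma> \<inter> frontier (closure \<sigma>) = {}"
    unfolding frontier_face(2)[OF \<sigma>] using face_disjoint_graph[OF \<sigma>] unfolding face_sides_def by blast
  then show sub: "\<sigma> \<subseteq> interior (closure \<sigma>)"
    using closure_subset[of \<sigma>] unfolding frontier_def by auto
  have "interior (closure \<sigma>) homeomorphic interior (cball (0::real^2) 1)"
    by (rule homeomorphic_interiors_same_dimension[OF closed_face(1)[OF closure_face[OF \<sigma>]]]) simp
  then have "connected (interior (closure \<sigma>))" by (simp add: homeomorphic_connectedness)
  moreover have "interior (closure \<sigma>) \<subseteq> - (V \<union> \<Union>E)" using graph_disjoint_interior[OF \<sigma>] by blast
  moreover have "\<sigma> \<inter> interior (closure \<sigma>) \<noteq> {}" using sub face_nonempty[OF \<sigma>] by blast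
  ultimately show "interior (closure \<sigma>) \<subseteq> \<sigma>"
    using components_maximal \<sigma> unfolding faces_def by metis
qed

text \<open>The axioms count closed faces while the curvature sums over open ones; injectivity makes
  the two counts agree.\<close>

lemma inj_on_closure_faces: "inj_on closure (faces V E)"
  by (rule inj_on_inverseI[of _ interior]) (simp add: face_eq_interior[symmetric])

lemma edge_subset_closed_face:
  assumes "\<sigma> \<in> faces V E" "e \<in> E"
  shows "e \<subseteq> closure \<sigma> \<longleftrightarrow> e \<in> face_sides \<sigma>"
  using edge_disjoint_interior[OF assms] assms(2) unfolding face_sides_def frontier_def by auto

lemma face_vertices_eq:
  assumes "\<sigma> \<in> faces V E"
  shows "face_vertices V \<sigma> = (\<Union>e\<in>face_sides \<sigma>. e \<inter> V)"
proof -
  have "V \<inter> closure \<sigma> = V \<inter> frontier (closure \<sigma>)"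
    using graph_disjoint_interior[OF assms] unfolding frontier_def by auto
  then show ?thesis unfolding face_vertices_def frontier_face(2)[OF assms] by auto
qed

lemma card_face_sides_at:
  assumes \<sigma>: "\<sigma> \<in> faces V E" and v: "v \<in> face_vertices V \<sigma>"
  shows "card {e \<in> face_sides \<sigma>. v \<in> e} = 2"
proof (rule circle_two_arcs_at_point)
  have "compact (closure \<sigma>)"
    using closed_face(1)[OF closure_face[OF \<sigma>]] homeomorphic_compactness compact_cball by blast
  then show "frontier (closure \<sigma>) homeomorphic sphere (0::real^2) 1"
    using homeomorphic_frontiers_same_dimension[OF closed_face(1)[OF closure_face[OF \<sigma>]]] by simp
  show "finite (face_sides \<sigma>)" "\<Union>(face_sides \<sigma>) = frontier (closure \<sigma>)"
    using frontier_face[OF \<sigma>] by simp_all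
  show "v \<in> frontier (closure \<sigma>)"
    using v unfolding face_vertices_eq[OF \<sigma>] frontier_face(2)[OF \<sigma>] by blast
  show "\<exists>g. arc g \<and> path_image g = e \<and> (v \<in> e \<longrightarrow> v \<in> {pathstart g, pathfinish g})"
    if "e \<in> face_sides \<sigma>" for e
  proof -
    have "e \<in> E" using that unfolding face_sides_def by simp
    then obtain g where g: "arc g" "path_image g = e" "e \<inter> V = {pathstart g, pathfinish g}" by (rule edge_arc)
    have "v \<in> {pathstart g, pathfinish g}" if "v \<in> e"
      using v that unfolding face_vertices_def g(3)[symmetric] by simp
    then show ?thesis using g(1,2) by (intro exI[of _ g]) simp
  qed
  show "finite (e \<inter> e')" if "e \<in> face_sides \<sigma>" "e' \<in> face_sides \<sigma>" "e \<noteq> e'" for e e'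
    using that finite_edges_meet unfolding face_sides_def by simp
qed

lemma card_faces_with_side:
  assumes e: "e \<in> E"
  shows "card {\<sigma> \<in> faces V E. e \<in> face_sides \<sigma>} = 2"
proof -
  have "closure ` {\<sigma> \<in> faces V E. e \<in> face_sides \<sigma>} = {D \<in> closed_faces V E. e \<subseteq> D}"
    unfolding closed_faces_def using edge_subset_closed_face[OF _ e] by auto
  moreover have "inj_on closure {\<sigma> \<in> faces V E. e \<in> face_sides \<sigma>}"
    using inj_on_closure_faces by (rule inj_on_subset) auto
  moreover have "card {D \<in> closed_faces V E. e \<subseteq> D} = 2"
    using tess e unfolding infinite_planar_tessellation_def by simp
  ultimately show ?thesis using card_image[of closure "{\<sigma> \<in> faces V E. e \<in> face_sides \<sigma>}"] by simp
qed

end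

section \<open>The tessellation as a four-regular complex\<close>

locale nonneg_four_regular_tessellation = planar_tessellation +
  assumes degree_4: "\<And>x. x \<in> V \<Longrightarrow> vertex_degree E x = 4"
    and curvature_nonneg: "\<And>x. x \<in> V \<Longrightarrow> 0 \<le> curvature V E x"
begin

sublocale four_regular_complex V E "faces V E" "\<lambda>e. e \<inter> V" face_sides
proof
  show "e \<inter> V \<subseteq> V" for e by simp
  show "e = e'" if "e \<in> E" "e' \<in> E" "e \<inter> V = e' \<inter> V" for e e'
    using tess that unfolding infinite_planar_tessellation_def simple_plane_graph_def by simp
  show "card {e \<in> E. v \<in> e \<inter> V} = 4" if "v \<in> V" for v
    using degree_4[OF that] that unfolding vertex_degree_def by simp
  show "face_sides f \<subseteq> E" for f unfolding face_sides_def by simp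
  show "3 \<le> card (face_sides f)" if "f \<in> faces V E" for f
    using tess that unfolding infinite_planar_tessellation_def face_degree_def face_sides_def by simp
  show "card {e \<in> face_sides f. v \<in> e \<inter> V} = 2"
    if "f \<in> faces V E" "e \<in> face_sides f" "v \<in> e \<inter> V" for f e v
  proof -
    have "v \<in> face_vertices V f" using that(2,3) unfolding face_vertices_eq[OF that(1)] by blast
    moreover have "{e \<in> face_sides f. v \<in> e \<inter> V} = {e \<in> face_sides f. v \<in> e}" using that(3) by auto
    ultimately show ?thesis using card_face_sides_at[OF that(1)] by simp
  qed
  show "v \<in> e \<inter> V"
    if fg: "f \<in> faces V E" "g \<in> faces V E" "f \<noteq> g" and e: "e \<in> face_sides f" "e \<in> face_sides g"
      and v: "a \<in> face_sides f" "v \<in> a \<inter> V" "b \<in> face_sides g" "v \<in> b \<inter> V" for f g e a b v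
  proof -
    have E: "e \<in> E" "a \<in> E" "b \<in> E" using e v unfolding face_sides_def by simp_all
    have "closure f \<noteq> closure g" using inj_on_closure_faces fg unfolding inj_on_def by auto
    then have "closure f \<inter> closure g = e"
      using faces_meet_edge[OF fg(1,2) E(1)] edge_subset_closed_face fg E e by simp
    moreover have "a \<subseteq> closure f" "b \<subseteq> closure g" using edge_subset_closed_face fg E v by simp_all
    ultimately show ?thesis using v by auto
  qed
qed (use card_edge_ends card_faces_with_side in auto)

lemma corners_eq: "\<sigma> \<in> faces V E \<Longrightarrow> corners \<sigma> = face_vertices V \<sigma>"
  unfolding corners_def by (rule face_vertices_eq[symmetric])

lemma face_degree_eq: "face_degree E \<sigma> = card (face_sides \<sigma>)"
  unfolding face_degree_def face_sides_def ..

lemma curv_eq: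
  assumes "v \<in> V"
  shows "curv v = curvature V E v"
proof -
  have "{f. f \<in> faces V E \<and> v \<in> corners f} = {f. f \<in> faces V E \<and> v \<in> closure f}"
    using assms corners_eq unfolding face_vertices_def by auto
  then show ?thesis unfolding curv_def curvature_def degree_4[OF assms] face_degree_eq by simp
qed

sublocale nonneg_four_regular_complex V E "faces V E" "\<lambda>e. e \<inter> V" face_sides
  by unfold_locales (simp add: curv_eq curvature_nonneg)

text \<open>A \<open>sum\<close> over an infinite index set is 0 by convention, so finiteness is
  required before the sum in \<open>modified_curvature\<close> can be bounded below.\<close>

lemma finite_adjacent:
  assumes "z \<in> V"
  shows "finite {y. adjacent V E y z}"
proof -
  have "0 < card {e \<in> E. z \<in> e}" using degree_4[OF assms] unfolding vertex_degree_def by simp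
  then have "finite (\<Union>e\<in>{e \<in> E. z \<in> e}. e \<inter> V)"
    using finite_edge_ends by (intro finite_UN_I) (auto intro: card_ge_0_finite)
  moreover have "{y. adjacent V E y z} \<subseteq> (\<Union>e\<in>{e \<in> E. z \<in> e}. e \<inter> V)"
    unfolding adjacent_def by auto
  ultimately show ?thesis by (rule rev_finite_subset)
qed

text \<open>Both outer neighbours belong to \<open>large_face_neighbours\<close> because of
  \<open>\<sigma>\<close> itself, and all other terms of the sum are nonnegative. Distinctness of
  \<open>p\<close> and \<open>q\<close> lets both be counted.\<close>

lemma modified_curvature_ge:
  assumes \<sigma>: "\<sigma> \<in> faces V E" "8 \<le> face_degree E \<sigma>" "face_degree E \<sigma> \<le> 12"
    and z: "z \<in> face_vertices V \<sigma>"
    and c: "c \<in> E" "c \<inter> V = {z, p}" and d: "d \<in> E" "d \<inter> V = {z, q}" and pq: "p \<noteq> q"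
    and out: "p \<notin> face_vertices V \<sigma>" "q \<notin> face_vertices V \<sigma>"
  shows "curvature V E z + (curvature V E p + curvature V E q) / 2 \<le> modified_curvature V E z"
proof -
  let ?S = "{y. y \<in> large_face_neighbours V E \<and> adjacent V E y z}"
  have adj: "adjacent V E p z" "adjacent V E q z"
    using c d unfolding adjacent_def by (auto simp: insert_commute)
  have "p \<in> V" "q \<in> V" using c d by auto
  then have "p \<in> face_nbhd_boundary V E \<sigma>" "q \<in> face_nbhd_boundary V E \<sigma>"
    using adj z out unfolding face_nbhd_boundary_def face_nbhd_def by auto
  then have sub: "{p, q} \<subseteq> ?S" using adj \<sigma> unfolding large_face_neighbours_def by auto
  have "z \<in> V" using z unfolding face_vertices_def by simp
  then have fin: "finite ?S" using finite_adjacent by (simp add: rev_finite_subset)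
  have "0 \<le> curvature V E y" if "y \<in> ?S" for y
    using that curvature_nonneg unfolding adjacent_def by auto
  then have "(\<Sum>y\<in>{p, q}. curvature V E y) \<le> (\<Sum>y\<in>?S. curvature V E y)"
    by (intro sum_mono2[OF fin sub]) auto
  then show ?thesis using pq unfolding modified_curvature_def by simp
qed

lemma modified_curvature_sum_ge:
  assumes \<sigma>: "\<sigma> \<in> faces V E" "8 \<le> face_degree E \<sigma>" "face_degree E \<sigma> \<le> 12"
  shows "1 - face_degree E \<sigma> / 24 \<le> (\<Sum>z\<in>face_vertices V \<sigma>. modified_curvature V E z)"
  unfolding face_degree_eq corners_eq[OF \<sigma>(1), symmetric]
proof (rule modified_curvature_sum_bound[OF \<sigma>(1)])
  show "8 \<le> card (face_sides \<sigma>)" using \<sigma>(2) unfolding face_degree_eq .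
  fix z c d p q
  assume *: "z \<in> corners \<sigma>" "c \<in> E" "d \<in> E" "c \<inter> V = {z, p}" "d \<inter> V = {z, q}" "p \<noteq> q"
    "p \<notin> corners \<sigma>" "q \<notin> corners \<sigma>"
  then have "z \<in> V" "p \<in> V" "q \<in> V" by auto
  then show "curv z + (curv p + curv q) / 2 \<le> modified_curvature V E z"
    using modified_curvature_ge[OF \<sigma> _ *(2,4,3,5,6)] *(1,7,8) unfolding corners_eq[OF \<sigma>(1)]
    by (simp add: curv_eq)
qed

end

theorem theorem5p2:
  fixes V :: "(real^2) set" and E :: "(real^2) set set" and \<sigma> :: "(real^2) set" and k :: nat
  assumes "infinite_planar_tessellation V E"
    and "\<forall>x\<in>V. vertex_degree E x = 4"
    and "\<forall>x\<in>V. curvature V E x \<ge> 0"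
    and "\<sigma> \<in> faces V E"
    and "face_degree E \<sigma> = k"
    and "8 \<le> k" and "k \<le> 12"
  shows "(8 \<le> k \<and> k \<le> 11 \<longrightarrow> (\<Sum>z\<in>face_vertices V \<sigma>. modified_curvature V E z) > 1/2) \<and>
         (k = 12 \<longrightarrow> (\<Sum>z\<in>face_vertices V \<sigma>. modified_curvature V E z) \<ge> 1/2)"
proof -
  interpret nonneg_four_regular_tessellation V E
    using assms(1-3) by unfold_locales auto
  have "1 - real k / 24 \<le> (\<Sum>z\<in>face_vertices V \<sigma>. modified_curvature V E z)"
    using modified_curvature_sum_ge[OF assms(4)] unfolding assms(5) using assms(6,7) .
  \<comment> \<open>The bound is 13/24 at \<open>k = 11\<close> and exactly 1/2 at
    \<open>k = 12\<close>, whence the strict and the weak inequality.\<close>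
  moreover have "1 / 2 < 1 - real k / 24" if "k \<le> 11" using that by simp
  moreover have "1 / 2 \<le> 1 - real k / 24" using assms(7) by simp
  ultimately show ?thesis by (metis less_le_trans order_trans)
qed

end
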